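(* Let $A$ be a finite set and $\sim$ an equivalence relation on $A$ with $||\sim||=n$. Set $n_1=n$ and $e_1=\lfloor n\rfloor_{\diamondsuit}$, and recursively define the finite sequences of integers $$n_j=n-\sum_{i<j}e_i(e_i-1),\qquad e_j=\lfloor n_j\rfloor_{\diamondsuit},$$ continuing as long as $n_j>0$. Let $\mathcal{X}'=\{40,238,922,1188,2344\}$. If none of the $n_j$ is in $\mathcal{X}'$, then $\mathrm{cost}(\sim)\ge\sum_j(e_j-1)$, and in particular $\mathrm{cost}(n)=\sum_j(e_j-1)$. If any one of the $n_j$ is in $\mathcal{X}'$, then it is the only such $n_j$, and $\mathrm{cost}(n)=-1+\sum_j(e_j-1)$.
   Context: Let $\sim$ be an equivalence relation on a finite set whose equivalence classes have sizes $s_1,\dots,s_k$. Its total cost is $\mathrm{cost}(\sim)=\sum_{i=1}^k(s_i-1)$. Its size is the number of equivalent ordered pairs of distinct elements, $||\sim||=\sum_{i=1}^k s_i(s_i-1)$. For an even natural number $n$, the minimum cost $\mathrm{cost}(n)$ is the minimum of $\mathrm{cost}(\sim)$ over all equivalence relations $\sim$ (on finite sets) of size $n$. The rhombic floor of $n$ is $\lfloor n\rfloor_{\diamondsuit}=\max\{t\in\mathbb{N}: t(t-1)\le n\}$. *)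

theory Defs
  imports Main
begin

definition eq_cost :: "'a set \<Rightarrow> ('a \<times> 'a) set \<Rightarrow> nat" where
  "eq_cost A r = (\<Sum>C\<in>A // r. card C - 1)"

definition eq_size :: "('a \<times> 'a) set \<Rightarrow> nat" where
  "eq_size r = card {(x, y) \<in> r. x \<noteq> y}"

lemma eq_size_eq_sum:
  assumes "finite A" "equiv A r"
  shows "eq_size r = (\<Sum>C\<in>A // r. card C * (card C - 1))"
proof -
  let ?D = "\<lambda>C. C \<times> C - Id_on C"
  have fin: "finite C" if "C \<in> A // r" for C
    using that assms by (meson equiv_def finite_equiv_class)
  have card_D: "card (?D C) = card C * (card C - 1)" if "finite C" for C :: "'a set"
  proof -
    have "Id_on C = (\<lambda>x. (x, x)) ` C" by auto
    then have "card (Id_on C) = card C" by (simp add: card_image inj_on_def)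
    moreover have "finite (Id_on C)" using that \<open>Id_on C = _\<close> by simp
    moreover have "Id_on C \<subseteq> C \<times> C" by auto
    ultimately show ?thesis
      by (simp add: card_Diff_subset card_cartesian_product diff_mult_distrib2)
  qed
  have "{(x, y) \<in> r. x \<noteq> y} = (\<Union>C\<in>A // r. ?D C)"
  proof (intro equalityI subsetI; clarify)
    fix x y assume xy: "(x, y) \<in> r" "x \<noteq> y"
    then have "x \<in> A" using assms(2) by (auto simp: equiv_def)
    then have "r `` {x} \<in> A // r" "x \<in> r `` {x}" "y \<in> r `` {x}"
      using xy assms(2) equiv_class_self[OF assms(2)] by (auto intro: quotientI)
    then show "(x, y) \<in> (\<Union>C\<in>A // r. ?D C)" using xy by blast
  next
    fix x y C assume "C \<in> A // r" "x \<in> C" "y \<in> C" "(x, y) \<notin> Id_on C"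
    then show "(x, y) \<in> r \<and> x \<noteq> y"
      using quotient_eq_iff[OF assms(2)] by blast
  qed
  then have "eq_size r = card (\<Union>C\<in>A // r. ?D C)" by (simp add: eq_size_def)
  also have "\<dots> = (\<Sum>C\<in>A // r. card (?D C))"
  proof (rule card_UN_disjoint)
    show "finite (A // r)" using assms by (meson equiv_def finite_quotient)
    show "\<forall>C\<in>A // r. finite (?D C)" using fin by blast
    show "\<forall>C\<in>A // r. \<forall>D\<in>A // r. C \<noteq> D \<longrightarrow> ?D C \<inter> ?D D = {}"
      using quotient_disj[OF assms(2)] by blast
  qed
  also have "\<dots> = (\<Sum>C\<in>A // r. card C * (card C - 1))"
    using fin by (intro sum.cong) (auto simp: card_D)
  finally show ?thesis .
qed

text \<open>
  Every finite set is in bijection with a set of natural numbers, so relations on sets of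
  natural numbers suffice in the definition of the minimum cost; see \<open>min_cost_le\<close> and
  \<open>min_cost_attained\<close>. For odd \<open>n\<close> there is no relation of size \<open>n\<close> and the value of
  \<open>min_cost n\<close> is meaningless.
\<close>

definition min_cost :: "nat \<Rightarrow> nat" where
  "min_cost n = (LEAST c. \<exists>(A :: nat set) r.
     finite A \<and> equiv A r \<and> eq_size r = n \<and> eq_cost A r = c)"

lemma equiv_transport_nat:
  fixes A :: "'a set"
  assumes "finite A" "equiv A r"
  shows "\<exists>(B :: nat set) s. finite B \<and> equiv B s \<and> eq_size s = eq_size r \<and> eq_cost B s = eq_cost A r"
proof -
  obtain f :: "'a \<Rightarrow> nat" where f: "inj_on f A"
    using finite_imp_inj_to_nat_seg[OF assms(1)] by blast
  define s where "s = map_prod f f ` r"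
  have rA: "r \<subseteq> A \<times> A" using assms(2) by (simp add: equiv_def)
  have s_iff: "(f x, f y) \<in> s \<longleftrightarrow> (x, y) \<in> r" if "x \<in> A" "y \<in> A" for x y
  proof
    assume "(f x, f y) \<in> s"
    then obtain u v where uv: "(u, v) \<in> r" "f x = f u" "f y = f v" by (auto simp: s_def)
    then have "u \<in> A" "v \<in> A" using rA by blast+
    then show "(x, y) \<in> r" using uv that f by (metis inj_onD)
  qed (auto simp: s_def)
  have sB: "s \<subseteq> f ` A \<times> f ` A" using rA by (auto simp: s_def)
  have eq: "equiv (f ` A) s"
  proof (rule equivI)
    show "s \<subseteq> f ` A \<times> f ` A" by (fact sB)
    show "refl_on (f ` A) s"
      using assms(2) s_iff by (auto simp: equiv_def refl_on_def)
    show "sym s" using assms(2) by (auto simp: equiv_def sym_def s_def)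
    show "trans s"
    proof (rule transI)
      fix u v w assume uv: "(u, v) \<in> s" "(v, w) \<in> s"
      then obtain x y z where "x \<in> A" "y \<in> A" "z \<in> A" "u = f x" "v = f y" "w = f z"
        using sB by blast
      then show "(u, w) \<in> s"
        using uv s_iff assms(2) by (metis equiv_def transD)
    qed
  qed
  have quot: "f ` A // s = (`) f ` (A // r)"
  proof -
    have "s `` {f x} = f ` (r `` {x})" if "x \<in> A" for x
    proof (intro equalityI subsetI)
      fix v assume "v \<in> s `` {f x}"
      then obtain y where "y \<in> A" "v = f y" "(f x, f y) \<in> s" using sB by blast
      then show "v \<in> f ` (r `` {x})" using s_iff[OF that] by blast
    qed (auto simp: s_def)
    then show ?thesis by (auto simp: quotient_def)
  qed
  have sub: "C \<subseteq> A" if "C \<in> A // r" for C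
    using that assms(2) in_quotient_imp_subset by metis
  have inj: "inj_on ((`) f) (A // r)"
    using f sub by (meson inj_onI inj_on_image_eq_iff)
  have "eq_size s = eq_size r"
  proof -
    have "{(x, y) \<in> s. x \<noteq> y} = map_prod f f ` {(x, y) \<in> r. x \<noteq> y}"
    proof -
      have "f x \<noteq> f y" if "(x, y) \<in> r" "x \<noteq> y" for x y
        using that rA f by (meson SigmaD1 SigmaD2 inj_onD subsetD)
      then show ?thesis unfolding s_def by auto
    qed
    moreover have "inj_on (map_prod f f) {(x, y) \<in> r. x \<noteq> y}"
      using rA by (intro inj_on_subset[OF map_prod_inj_on[OF f f]]) auto
    ultimately show ?thesis by (simp add: eq_size_def card_image)
  qed
  moreover have "eq_cost (f ` A) s = eq_cost A r"
  proof -
    have "card (f ` C) = card C" if "C \<in> A // r" for C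
      using sub[OF that] f by (meson card_image inj_on_subset)
    then show ?thesis
      unfolding eq_cost_def quot by (simp add: sum.reindex[OF inj])
  qed
  ultimately show ?thesis using eq assms(1) by blast
qed

lemma min_cost_le:
  fixes A :: "'a set"
  assumes "finite A" "equiv A r" "eq_size r = n"
  shows "min_cost n \<le> eq_cost A r"
  unfolding min_cost_def
  using equiv_transport_nat[OF assms(1,2)] assms(3) by (intro Least_le) metis

lemma exists_equiv_of_even_size:
  assumes "even n"
  shows "\<exists>(A :: nat set) r. finite A \<and> equiv A r \<and> eq_size r = n"
proof -
  obtain m where m: "n = 2 * m" using assms by blast
  define g :: "nat \<Rightarrow> nat" where "g x = x div 2" for x
  define A where "A = {..<2 * m}"
  define r where "r = {(x, y). x \<in> A \<and> y \<in> A \<and> g x = g y}"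
  define p :: "nat \<Rightarrow> nat" where "p x = (if even x then x + 1 else x - 1)" for x
  have "equiv A r"
    by (rule equivI) (auto simp: r_def refl_on_def sym_def trans_def)
  moreover have "{(x, y) \<in> r. x \<noteq> y} = (\<lambda>x. (x, p x)) ` A"
  proof (rule set_eqI, clarify)
    fix x y :: nat
    have "x < 2 * m \<and> y < 2 * m \<and> x div 2 = y div 2 \<and> x \<noteq> y \<longleftrightarrow> x < 2 * m \<and> y = p x"
      unfolding p_def by (cases "even x") (auto elim!: evenE oddE)
    then show "(x, y) \<in> {(x, y) \<in> r. x \<noteq> y} \<longleftrightarrow> (x, y) \<in> (\<lambda>x. (x, p x)) ` A"
      by (auto simp: r_def A_def g_def)
  qed
  then have "eq_size r = n"
    by (simp add: eq_size_def card_image inj_on_def A_def m)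
  ultimately show ?thesis by (intro exI[of _ A] exI[of _ r]) (simp add: A_def)
qed

lemma min_cost_attained:
  assumes "even n"
  shows "\<exists>(A :: nat set) r. finite A \<and> equiv A r \<and> eq_size r = n \<and> eq_cost A r = min_cost n"
  unfolding min_cost_def
  by (rule LeastI_ex) (use exists_equiv_of_even_size[OF assms] in blast)

definition rhombic_floor :: "nat \<Rightarrow> nat" where
  "rhombic_floor n = Max {t. t * (t - 1) \<le> n}"

lemma finite_rhombic: "finite {t :: nat. t * (t - 1) \<le> n}"
proof (rule finite_subset)
  show "{t :: nat. t * (t - 1) \<le> n} \<subseteq> {..n + 1}"
  proof
    fix t :: nat assume t: "t \<in> {t. t * (t - 1) \<le> n}"
    show "t \<in> {..n + 1}"
    proof (rule ccontr)
      assume "t \<notin> {..n + 1}"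
      then have "1 * (n + 1) \<le> t * (t - 1)" by (intro mult_mono) auto
      with t show False by simp
    qed
  qed
qed simp

lemma rhombic_floor_le: "rhombic_floor n * (rhombic_floor n - 1) \<le> n"
proof -
  have "{t :: nat. t * (t - 1) \<le> n} \<noteq> {}" by (auto intro: exI[of _ 0])
  from Max_in[OF finite_rhombic this] show ?thesis by (simp add: rhombic_floor_def)
qed

text \<open>
  The indices start at 1, so the value at \<open>j = 0\<close> plays no role. The function is total; for
  even \<open>n\<close> (the only possible sizes) it reaches 0 and stays there, and \<open>greedy_steps\<close> cuts this off. The natural number
  subtraction is never truncated, by \<open>greedy_rem_add\<close>.
\<close>

fun greedy_rem :: "nat \<Rightarrow> nat \<Rightarrow> nat" where
  "greedy_rem n j =
     n - (\<Sum>i = 1..<j. rhombic_floor (greedy_rem n i) * (rhombic_floor (greedy_rem n i) - 1))"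

declare greedy_rem.simps [simp del]

definition greedy_part :: "nat \<Rightarrow> nat \<Rightarrow> nat" where
  "greedy_part n j = rhombic_floor (greedy_rem n j)"

definition greedy_steps :: "nat \<Rightarrow> nat set" where
  "greedy_steps n = {j. 1 \<le> j \<and> greedy_rem n j > 0}"

lemma greedy_rem_eq:
  "greedy_rem n j = n - (\<Sum>i = 1..<j. greedy_part n i * (greedy_part n i - 1))"
  unfolding greedy_part_def by (rule greedy_rem.simps)

lemma greedy_rem_add:
  "greedy_rem n j + (\<Sum>i = 1..<j. greedy_part n i * (greedy_part n i - 1)) = n"
proof (induction j)
  case 0
  show ?case by (simp add: greedy_rem_eq)
next
  case (Suc j)
  show ?case
  proof (cases "j = 0")
    case False
    have "greedy_part n j * (greedy_part n j - 1) \<le> greedy_rem n j"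
      unfolding greedy_part_def by (rule rhombic_floor_le)
    with False Suc show ?thesis by (subst greedy_rem_eq) simp
  qed (simp add: greedy_rem_eq)
qed

lemma even_greedy_rem:
  assumes "even n"
  shows "even (greedy_rem n j)"
proof -
  have "even (\<Sum>i = 1..<j. greedy_part n i * (greedy_part n i - 1))"
    by (rule dvd_sum) (auto simp: even_diff_nat)
  then show ?thesis using assms greedy_rem_add[of n j] by (metis even_add)
qed

lemma finite_greedy_steps:
  assumes "even n"
  shows "finite (greedy_steps n)"
proof -
  have "greedy_rem n j + (j - 1) \<le> n" if "j \<in> greedy_steps n" for j
  proof -
    have "1 \<le> greedy_part n i * (greedy_part n i - 1)" if i: "i \<in> {1..<j}" for i
    proof -
      have "greedy_rem n j \<le> greedy_rem n i"
        unfolding greedy_rem_eq[of n j] greedy_rem_eq[of n i]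
        using i by (intro diff_le_mono2 sum_mono2) auto
      then have "greedy_rem n i > 0" using \<open>j \<in> greedy_steps n\<close> by (simp add: greedy_steps_def)
      then have "greedy_rem n i \<ge> 2" using even_greedy_rem[OF assms, of i] by presburger
      then have "2 \<in> {t :: nat. t * (t - 1) \<le> greedy_rem n i}" by simp
      then have "2 \<le> greedy_part n i"
        unfolding greedy_part_def rhombic_floor_def by (rule Max_ge[OF finite_rhombic])
      then have "1 * 1 \<le> greedy_part n i * (greedy_part n i - 1)" by (intro mult_mono) auto
      then show ?thesis by simp
    qed
    then have "(\<Sum>i = 1..<j. 1) \<le> (\<Sum>i = 1..<j. greedy_part n i * (greedy_part n i - 1))"
      by (rule sum_mono)
    then show ?thesis using greedy_rem_add[of n j] by simp
  qed
  then have "greedy_steps n \<subseteq> {..n + 1}" by fastforce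
  then show ?thesis by (rule finite_subset) simp
qed

definition exceptional :: "nat set" where
  "exceptional = {40, 238, 922, 1188, 2344}"

end

theory Submission
  imports Defs "HOL-Library.Code_Binary_Nat"
begin

text \<open>
  A class of \<open>m + 1\<close> elements costs \<open>m\<close> and contributes \<open>m (m + 1)\<close> to the size, so the problem is
  to write an even \<open>n\<close> as a sum of numbers \<open>m (m + 1)\<close> with the least possible sum of the \<open>m\<close>. Every
  even \<open>n\<close> is \<open>M (M + 1) + r\<close> for unique \<open>M\<close> and even \<open>r \<le> 2 M\<close>; the greedy choice takes the part
  \<open>M\<close> and goes on with \<open>r\<close>. Let \<open>opt_cost\<close> be the greedy cost, lowered by one at each exceptional
  remainder. Then \<open>opt_cost n = M + F\<close> with \<open>F = opt_cost r\<close> unless \<open>n\<close> is exceptional.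

  That \<open>opt_cost\<close> is a lower bound (\<open>opt_cost_le_sum\<close>) is proved by removing the largest part \<open>m\<close>.
  Let \<open>a\<close> be what remains of \<open>n\<close>. By induction the cost \<open>c\<close> is at least \<open>opt_cost a + m\<close>, and, since
  no part exceeds \<open>m\<close>, also \<open>n \<le> (m + 1) c\<close>. The heart of the matter is that these two
  inequalities force \<open>opt_cost n \<le> c\<close> (\<open>opt_cost_exchange\<close>). The case \<open>m = M\<close> is the greedy choice.
  For \<open>m < M\<close> three estimates compete.

  \<^item> Parts with \<open>\<Sum> m = x\<close> have size at most \<open>x (x + 1)\<close>, so \<open>a \<le> opt_cost a (opt_cost a + 1)\<close>: for
    \<open>m = M - k\<close> with small \<open>k\<close> the remainder \<open>a\<close> is about \<open>r + 2 k M\<close>, which costs at least about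
    the square root of this.
  \<^item> \<open>F\<close> is at most \<open>sqrt r \<le> sqrt (2 M)\<close> plus a term of lower order. As the saving from using \<open>M - k\<close> in
    place of \<open>M\<close> is only \<open>k\<close>, the remainder \<open>a\<close> is too expensive for \<open>2 \<le> k\<close> and \<open>m > F\<close>; by
    convexity in \<open>k\<close> it is enough to check the two ends of this range.
  \<^item> For \<open>m \<le> F\<close> the inequality \<open>n \<le> (m + 1) c\<close> makes \<open>c\<close> too large.

  The estimates on \<open>F\<close> (\<open>small_cost_opt_cost\<close>) hold for every large \<open>r\<close> and fail for few small ones.
  The only serious competition is from \<open>m = M - 1\<close> with \<open>r \<in> {10, 28, 52, 66, 88}\<close> and \<open>M\<close> close to
  \<open>r / 2\<close>. In each of these cases a single \<open>M\<close> gives a representation cheaper than the greedy one,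
  and the five numbers \<open>M (M + 1) + r\<close> are exactly the exceptional ones; for them, the same
  estimates with \<open>F - 1\<close> in place of \<open>F\<close> show that one unit is all that can be saved.

  Conversely, \<open>opt_cost\<close> is attained by adding greedy classes one at a time, and for an exceptional
  number by two classes. The chain of remainders of an exceptional number contains no other
  exceptional number, so at most one unit is ever subtracted from the greedy cost.
\<close>

section \<open>The greedy recursion\<close>

lemma rhombic_floor_eqI:
  assumes "t * (t - 1) \<le> n" and "n < (t + 1) * t"
  shows "rhombic_floor n = t"
  unfolding rhombic_floor_def
proof (rule Max_eqI[OF finite_rhombic])
  fix u assume "u \<in> {t. t * (t - 1) \<le> n}"
  then have u: "u * (u - 1) \<le> n" by simp
  show "u \<le> t"
  proof (rule ccontr)
    assume "\<not> u \<le> t"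
    then have "(t + 1) * t \<le> u * (u - 1)" by (intro mult_mono) auto
    with u assms(2) show False by simp
  qed
qed (use assms(1) in simp)

lemma rhombic_floor_block:
  assumes "r \<le> 2 * m + 1"
  shows "rhombic_floor (m * (m + 1) + r) = m + 1"
  using assms by (intro rhombic_floor_eqI) (auto simp: algebra_simps)

lemma obtain_block:
  fixes n :: nat
  obtains m r where "n = m * (m + 1) + r" and "r \<le> 2 * m + 1"
proof (induction n arbitrary: thesis)
  case 0
  show ?case by (rule 0[of 0 0]) auto
next
  case (Suc n)
  obtain m r where mr: "n = m * (m + 1) + r" "r \<le> 2 * m + 1" by (rule Suc.IH)
  show ?case
  proof (cases "r = 2 * m + 1")
    case True
    then show ?thesis using mr by (intro Suc.prems[of "m + 1" 0]) (auto simp: algebra_simps)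
  next
    case False
    then show ?thesis using mr by (intro Suc.prems[of m "r + 1"]) auto
  qed
qed

text \<open>The claimed minimum cost: the greedy cost, minus one for each exceptional remainder met on
  the way. The value at odd \<open>n\<close> has no meaning; the remainder 1 ends the recursion there.\<close>

function opt_cost :: "nat \<Rightarrow> nat" where
  "opt_cost n =
     (if n < 2 then 0
      else rhombic_floor n - 1 + opt_cost (n - rhombic_floor n * (rhombic_floor n - 1))
             - (if n \<in> exceptional then 1 else 0))"
  by auto
termination
proof (relation "measure id")
  fix n :: nat assume n: "\<not> n < 2"
  obtain m r where mr: "n = m * (m + 1) + r" "r \<le> 2 * m + 1" by (rule obtain_block)
  then have "m > 0" using n by (cases m) auto
  then show "(n - rhombic_floor n * (rhombic_floor n - 1), n) \<in> measure id"
    using rhombic_floor_block[OF mr(2)] mr n by auto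
qed auto

declare opt_cost.simps [simp del]

lemma opt_cost_0 [simp]: "opt_cost 0 = 0" and opt_cost_1 [simp]: "opt_cost (Suc 0) = 0"
  by (simp_all add: opt_cost.simps)

text \<open>One greedy step in coordinates. Writing \<open>n\<close> as \<open>m (m + 1) + r\<close> makes the rhombic floor
  disappear from all later arguments. All exceptional numbers have \<open>m \<ge> 5\<close>, so the
  subtraction is never truncated.\<close>

lemma opt_cost_block:
  assumes "r \<le> 2 * m + 1"
  shows "opt_cost (m * (m + 1) + r)
    = m + opt_cost r - (if m * (m + 1) + r \<in> exceptional then 1 else 0)"
proof (cases "m = 0")
  case True
  then show ?thesis using assms by (cases r) (auto simp: exceptional_def)
next
  case False
  then have "\<not> m * (m + 1) + r < 2" by (cases m) auto
  then show ?thesis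
    by (subst opt_cost.simps) (simp only: rhombic_floor_block[OF assms], simp)
qed

lemma obtain_even_block:
  fixes n :: nat
  assumes "even n"
  obtains m R where "n = m * (m + 1) + 2 * R" and "R \<le> m"
proof -
  obtain m r where mr: "n = m * (m + 1) + r" "r \<le> 2 * m + 1" by (rule obtain_block)
  then have "even r" using assms by auto
  then obtain R where "r = 2 * R" by blast
  with mr show thesis by (intro that[of m R]) auto
qed

section \<open>Upper bounds for the optimal cost\<close>

text \<open>The values of \<open>opt_cost\<close> at \<open>0, 2, 4, \<dots>, 40\<close>. The remainder \<open>r\<close> of a number in a block
  \<open>s \<le> 20\<close> lies in this range, so the table determines \<open>opt_cost\<close> on these blocks.\<close>

definition opt_table :: "nat list" where
  "opt_table = [0,1,2,2,3,4,3,4,5,5,4,5,6,6,7,5,6,7,7,8,8]"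

lemma table_recursion:
  "\<forall>m\<in>set [0..<6]. \<forall>R\<in>set [0..<Suc m]. let n = m * (m + 1) + 2 * R in
     opt_table ! (n div 2) = m + opt_table ! R - (if n = 40 then 1 else 0)"
  by code_simp

lemma opt_cost_table:
  assumes "R \<le> 20"
  shows "opt_cost (2 * R) = opt_table ! R"
  using assms
proof (induction R rule: less_induct)
  case (less R)
  obtain m R' where mR: "2 * R = m * (m + 1) + 2 * R'" "R' \<le> m"
    by (rule obtain_even_block[of "2 * R"]) auto
  have "m < 6"
  proof (rule ccontr)
    assume "\<not> m < 6"
    then have "6 * 7 \<le> m * (m + 1)" by (intro mult_mono) auto
    with mR less.prems show False by simp
  qed
  show ?case
  proof (cases "m = 0")
    case True
    then show ?thesis using mR by (simp add: opt_table_def)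
  next
    case False
    then have "0 < m * (m + 1)" by simp
    then have "R' < R" using mR(1) by linarith
    then have "opt_cost (2 * R') = opt_table ! R'" using less by simp
    moreover have "2 * R \<in> exceptional \<longleftrightarrow> 2 * R = 40"
      using less.prems by (auto simp: exceptional_def)
    moreover have ranges: "m \<in> set [0..<6]" "R' \<in> set [0..<Suc m]"
      using \<open>m < 6\<close> mR(2) by auto
    ultimately have "opt_cost (2 * R) = m + opt_table ! R' - (if 2 * R = 40 then 1 else 0)"
      using opt_cost_block[of "2 * R'" m] mR by simp
    also have "\<dots> = opt_table ! (2 * R div 2)"
      using table_recursion[THEN bspec, THEN bspec, OF ranges]
      unfolding Let_def mR(1)[symmetric] by simp
    finally show ?thesis by simp
  qed
qed

text \<open>
  What the comparison of \<open>M\<close> with a smaller part needs to know about \<open>F = opt_cost r\<close>. As \<open>F\<close> is of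
  order \<open>sqrt r\<close> and \<open>M \<ge> r / 2\<close>, the first conditional bound excludes the part \<open>M - 1\<close>, the second excludes
  the parts from \<open>F + 1\<close> to \<open>M - 2\<close>, and the third excludes those up to \<open>F\<close>; the listed \<open>r\<close> are those at
  which the inequalities fail. The linear bound \<open>8 F \<le> r + 28\<close> is there for the induction: applied to the
  remainder of \<open>r\<close>, it shows that all later greedy steps together cost at most a quarter of the
  first one, up to a constant. The constant 28 is forced by \<open>opt_cost 28 = 7\<close>.
\<close>

definition small_cost :: "nat \<Rightarrow> nat \<Rightarrow> bool" where
  "small_cost r F \<longleftrightarrow> 8 * F \<le> r + 28 \<and> 2 * F \<le> r \<and>
     (r \<notin> set [0, 10, 28, 52, 66, 88] \<longrightarrow> F * F + F < 2 * r) \<and>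
     (r \<notin> set [0, 2, 4, 10] \<longrightarrow> F * F + 3 * F + 4 < 3 * r) \<and>
     (r \<noteq> 10 \<longrightarrow> 4 * (F * F) + 2 * F * r \<le> r * r + 4 * r)"

text \<open>Thanks to monotonicity it suffices to check an upper bound for \<open>opt_cost\<close>.\<close>

lemma small_cost_antimono:
  assumes "small_cost r F" and "G \<le> F"
  shows "small_cost r G"
proof -
  have sq: "G * G \<le> F * F" using assms(2) by (intro mult_mono) auto
  then have "4 * (G * G) + 2 * G * r \<le> 4 * (F * F) + 2 * F * r"
    using assms(2) by (intro add_mono mult_mono) auto
  then have "r \<noteq> 10 \<Longrightarrow> 4 * (G * G) + 2 * G * r \<le> r * r + 4 * r"
    using assms(1) unfolding small_cost_def by linarith
  with sq assms show ?thesis unfolding small_cost_def by auto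
qed

lemma small_cost_first_blocks:
  "\<forall>s\<in>set [0..<21]. \<forall>R\<in>set [0..<Suc s].
     small_cost (s * (s + 1) + 2 * R)
       (s + opt_table ! R - (if s * (s + 1) + 2 * R = 40 then 1 else 0))"
  by code_simp

text \<open>With \<open>r = s (s + 1) + 2 R\<close> and \<open>R \<le> s\<close>, the linear bound for \<open>2 R\<close> gives
  \<open>4 F \<le> 5 s + 14\<close>. Then \<open>F\<^sup>2\<close> is at most about \<open>25/16 s\<^sup>2\<close>, whereas the bounds allow
  \<open>2 s\<^sup>2\<close>; the lower order terms are absorbed exactly from \<open>s = 21\<close> on.\<close>

lemma small_cost_opt_cost:
  assumes "even r"
  shows "small_cost r (opt_cost r)"
  using assms
proof (induction r rule: less_induct)
  case (less r)
  obtain s R where sR: "r = s * (s + 1) + 2 * R" "R \<le> s"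
    by (rule obtain_even_block[OF less.prems])
  define F where "F = opt_cost r"
  have F: "F = s + opt_cost (2 * R) - (if r \<in> exceptional then 1 else 0)"
    unfolding F_def using opt_cost_block[of "2 * R" s] sR by simp
  have "small_cost r F"
  proof (cases "s < 21")
    case True
    \<comment> \<open>\<open>40\<close> is the one number whose greedy cost violates the bounds; that of \<open>238\<close> satisfies them.\<close>
    have "F \<le> s + opt_table ! R - (if r = 40 then 1 else 0)"
      using opt_cost_table[of R] True sR(2) unfolding F by (simp add: exceptional_def)
    moreover have "small_cost r (s + opt_table ! R - (if r = 40 then 1 else 0))"
      unfolding sR(1) by (rule small_cost_first_blocks[THEN bspec, THEN bspec]) (use True sR(2) in auto)
    ultimately show ?thesis by (metis small_cost_antimono)
  next
    case False
    define g where "g = opt_cost (2 * R)"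
    have "F \<le> s + g" using F by (simp add: g_def)
    have "2 * R < r" using False sR by (cases s) auto
    then have "small_cost (2 * R) g" unfolding g_def by (intro less.IH) auto
    then have g: "8 * g \<le> 2 * R + 28" by (simp add: small_cost_def)
    then have F4: "4 * F \<le> 5 * s + 14" using \<open>F \<le> s + g\<close> sR by linarith
    obtain d where d: "s = d + 21" using False by (metis add.commute le_Suc_ex not_less)
    have r: "r = d * d + 43 * d + 462 + 2 * R" using sR d by (simp add: algebra_simps)
    have "8 * F \<le> r + 28" using g \<open>F \<le> s + g\<close> r d by simp
    moreover from this have "2 * F \<le> r" using r by simp
    moreover have "(4 * F) * (4 * F) \<le> (5 * d + 119) * (5 * d + 119)"
      using F4 d by (intro mult_mono) auto
    then have FF: "16 * (F * F) \<le> 25 * (d * d) + 1190 * d + 14161"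
      by (simp add: algebra_simps)
    have "16 * (F * F) + 16 * F < 32 * r"
      using FF F4 r d by linarith
    then have "F * F + F < 2 * r" by simp
    moreover have "16 * (F * F) + 48 * F + 64 < 48 * r"
      using FF F4 r d by linarith
    then have "F * F + 3 * F + 4 < 3 * r" by simp
    moreover have "4 * (F * F) + 2 * F * r \<le> r * r + 4 * r"
    proof -
      have "4 * F \<le> r" using \<open>8 * F \<le> r + 28\<close> r by simp
      then have "4 * (F * F) \<le> F * r" "4 * (F * r) \<le> r * r"
        using mult_le_mono2[of "4 * F" r F] mult_le_mono2[of "4 * F" r r]
        by (simp_all add: algebra_simps)
      then have "4 * (F * F) + 2 * (F * r) \<le> r * r + 4 * r" by linarith
      then show ?thesis by (simp add: algebra_simps)
    qed
    ultimately show ?thesis unfolding small_cost_def by blast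
  qed
  then show ?case unfolding F_def .
qed

lemma opt_cost_exceptional:
  "opt_cost 40 = 8" "opt_cost 238 = 20" "opt_cost 922 = 38" "opt_cost 1188 = 43" "opt_cost 2344 = 59"
  "opt_cost 10 = 4" "opt_cost 28 = 7" "opt_cost 52 = 10" "opt_cost 66 = 11" "opt_cost 88 = 13"
proof -
  note t = opt_cost_table[of 5] opt_cost_table[of 14] opt_cost_table[of 8]
  show 10: "opt_cost 10 = 4" and 28: "opt_cost 28 = 7" using t by (simp_all add: opt_table_def)
  have 16: "opt_cost 16 = 5" using t by (simp add: opt_table_def)
  show 52: "opt_cost 52 = 10" using opt_cost_block[of 10 6] 10 by (simp add: exceptional_def)
  show 66: "opt_cost 66 = 11" using opt_cost_block[of 10 7] 10 by (simp add: exceptional_def)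
  show 88: "opt_cost 88 = 13" using opt_cost_block[of 16 8] 16 by (simp add: exceptional_def)
  show "opt_cost 40 = 8" using opt_cost_block[of 10 5] 10 by (simp add: exceptional_def)
  show "opt_cost 238 = 20" using opt_cost_block[of 28 14] 28 by (simp add: exceptional_def)
  show "opt_cost 922 = 38" using opt_cost_block[of 52 29] 52 by (simp add: exceptional_def)
  show "opt_cost 1188 = 43" using opt_cost_block[of 66 33] 66 by (simp add: exceptional_def)
  show "opt_cost 2344 = 59" using opt_cost_block[of 88 47] 88 by (simp add: exceptional_def)
qed

section \<open>The greedy part beats every smaller largest part\<close>

text \<open>The function \<open>x (x + 1)\<close> is superadditive, so one class is the largest size that a given cost
  can buy. The unit saved at an exceptional number is small against the slack in this bound.\<close>

lemma le_opt_cost_mult_Suc: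
  assumes "even n"
  shows "n \<le> opt_cost n * (opt_cost n + 1)"
  using assms
proof (induction n rule: less_induct)
  case (less n)
  show ?case
  proof (cases "n \<in> exceptional \<or> n = 0")
    case True
    then show ?thesis by (auto simp: exceptional_def opt_cost_exceptional)
  next
    case False
    obtain m R where n: "n = m * (m + 1) + 2 * R" "R \<le> m"
      by (rule obtain_even_block[OF less.prems])
    define g where "g = opt_cost (2 * R)"
    have "2 * R < n" using n False by (cases m) auto
    then have "2 * R \<le> g * (g + 1)" unfolding g_def by (intro less.IH) auto
    moreover have "opt_cost n = m + g"
      unfolding g_def using opt_cost_block[of "2 * R" m] n False by simp
    ultimately show ?thesis using n by (simp add: algebra_simps)
  qed
qed

text \<open>
  The arithmetic of the comparison: no largest part \<open>m < M\<close> leads to a cost below \<open>M + G\<close>. Here \<open>x\<close>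
  is the cost of the remainder \<open>a\<close> and \<open>c\<close> the total cost. With \<open>k = M - m\<close> the bound on \<open>a\<close> reads
  \<open>2 k\<^sup>2 - 2 k (M + 1 - G) + G\<^sup>2 - G - r \<ge> 0\<close>. The left side is convex in \<open>k\<close> and takes
  the same value at \<open>k = 2\<close> and \<open>k = M - 1 - G\<close>, namely \<open>G\<^sup>2 + 3 G + 4 - 4 M - r\<close>; so if this is
  negative, all \<open>k\<close> in between are excluded. This leaves \<open>k = 1\<close> and \<open>m \<le> G\<close>. The parameter \<open>G\<close> is
  \<open>opt_cost r\<close> in the regular case and one less in the exceptional case.
\<close>

lemma no_competitor:
  fixes M r G m a x c :: nat
  assumes m: "m < M" and a: "a + m * (m + 1) = M * (M + 1) + r"
    and ax: "a \<le> x * (x + 1)" and xc: "x + m \<le> c"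
    and crude: "M * (M + 1) + r \<le> (m + 1) * c" and c: "c < M + G"
    and k1: "M = m + 1 \<Longrightarrow> G * G + G < r + 2 * M"
    and k2: "G + 3 \<le> M \<Longrightarrow> G * G + 3 * G + 4 < r + 4 * M"
    and k3: "G * M + G * G \<le> M * M + r"
  shows False
proof (cases "m \<le> G")
  case True
  have "(m + 1) * c \<le> (G + 1) * (M + G - 1)" using True c by (intro mult_mono) auto
  moreover have "(G + 1) * (M + G - 1) + 1 = G * M + G * G + M"
    using m by (cases M) (auto simp: algebra_simps)
  ultimately have "M * (M + 1) + r + 1 \<le> G * M + G * G + M" using crude by linarith
  then show False using k3 by simp
next
  case False
  define k where "k = M - m"
  have M: "M = m + k" and "k \<ge> 1" using m by (auto simp: k_def)
  have "x + 1 \<le> k + G" using xc c M by simp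
  then have "x * (x + 1) \<le> (k + G - 1) * (k + G)" by (intro mult_mono) auto
  with ax have "a \<le> (k + G - 1) * (k + G)" by simp
  then have "int a \<le> int ((k + G - 1) * (k + G))" by (simp only: of_nat_le_iff)
  also have "\<dots> = (int k + int G - 1) * (int k + int G)" using \<open>k \<ge> 1\<close> by (simp add: of_nat_diff)
  finally have ak: "int a \<le> (int k + int G - 1) * (int k + int G)" .
  have ai: "int a + int m * (int m + 1) = (int m + int k) * (int m + int k + 1) + int r"
    using a unfolding M by (metis (mono_tags, lifting) of_nat_1 of_nat_add of_nat_mult)
  show False
  proof (cases "k = 1")
    case True
    then have "G * G + G < r + 2 * M" using M by (intro k1) simp
    then have "int G * int G + int G < int r + 2 * (int m + 1)" 
      unfolding M True by (metis (mono_tags, lifting) of_nat_1 of_nat_add of_nat_mult of_nat_less_iff of_nat_numeral)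
    then show False using ak ai True by (simp add: algebra_simps)
  next
    case False
    then have "k \<ge> 2" using \<open>k \<ge> 1\<close> by simp
    then have "G * G + 3 * G + 4 < r + 4 * M" using \<open>\<not> m \<le> G\<close> M by (intro k2) simp
    then have q: "int G * int G + 3 * int G + 4 < int r + 4 * (int m + int k)"
      unfolding M by (metis (mono_tags, lifting) of_nat_add of_nat_mult of_nat_less_iff of_nat_numeral)
    have "0 \<le> (int k - 2) * (int m - 1 - int G)"
      using \<open>k \<ge> 2\<close> \<open>\<not> m \<le> G\<close> by (intro mult_nonneg_nonneg) auto
    then show False using ak ai q by (simp add: algebra_simps)
  qed
qed

text \<open>The induction step of the lower bound. The two assumptions on \<open>c\<close> hold for the cost of any
  representation whose largest part is \<open>m\<close>, with \<open>a\<close> the sum of the others. In the regular case the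
  estimates on \<open>opt_cost r\<close> leave open \<open>m = M - 1\<close> for \<open>r = 52\<close>, \<open>26 \<le> M \<le> 28\<close> and for \<open>r = 88\<close>,
  \<open>44 \<le> M \<le> 46\<close>, where the cost of the remainder \<open>a = r + 2 M\<close> has to be computed.\<close>

lemma opt_cost_exchange:
  assumes "even a"
    and "opt_cost a + m \<le> c" and "a + m * (m + 1) \<le> (m + 1) * c"
  shows "opt_cost (a + m * (m + 1)) \<le> c"
proof (rule ccontr)
  define n where "n = a + m * (m + 1)"
  assume "\<not> opt_cost (a + m * (m + 1)) \<le> c"
  then have lt: "c < opt_cost n" by (simp add: n_def)
  have "even n" using assms(1) by (simp add: n_def)
  then obtain M R where n: "n = M * (M + 1) + 2 * R" "R \<le> M" by (rule obtain_even_block)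
  define r where "r = 2 * R"
  define F where "F = opt_cost r"
  have f: "opt_cost n = M + F - (if n \<in> exceptional then 1 else 0)"
    unfolding F_def r_def using opt_cost_block[of "2 * R" M] n by simp
  have sm: "small_cost r F" unfolding F_def by (intro small_cost_opt_cost) (simp add: r_def)
  have "m \<le> M"
  proof (rule ccontr)
    assume "\<not> m \<le> M"
    then have "(M + 1) * (M + 2) \<le> m * (m + 1)" by (intro mult_mono) auto
    then show False using n by (simp add: n_def algebra_simps)
  qed
  moreover have "m \<noteq> M"
  proof
    assume "m = M"
    then have "a = r" using n by (simp add: n_def r_def)
    then show False using assms(2) lt f \<open>m = M\<close> by (simp add: F_def)
  qed
  ultimately have "m < M" by simp
  have nr: "n = M * (M + 1) + r" using n by (simp add: r_def)
  have contra: False if "c < M + G" "M = m + 1 \<Longrightarrow> G * G + G < r + 2 * M"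
    "G + 3 \<le> M \<Longrightarrow> G * G + 3 * G + 4 < r + 4 * M" "G * M + G * G \<le> M * M + r" for G
  proof (rule no_competitor[of m M a r "opt_cost a" c G])
    show "a + m * (m + 1) = M * (M + 1) + r" using nr unfolding n_def .
    show "M * (M + 1) + r \<le> (m + 1) * c" using assms(3) nr unfolding n_def by simp
  qed (use that \<open>m < M\<close> assms(2) le_opt_cost_mult_Suc[OF assms(1)] in auto)
  show False
  proof (cases "n \<in> exceptional")
    case True
    have "(M, r) \<in> {(5, 10), (14, 28), (29, 52), (33, 66), (47, 88)}"
    proof -
      have block: "M = t \<and> r = q" if "n = t * (t + 1) + q" "q \<le> 2 * t" for t q
      proof -
        have "rhombic_floor n = t + 1" unfolding that(1) using that(2) by (intro rhombic_floor_block) simp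
        moreover have "rhombic_floor n = M + 1" unfolding n(1) using n(2) by (intro rhombic_floor_block) simp
        ultimately show ?thesis using that nr by simp
      qed
      show ?thesis
        using True block[of 5 10] block[of 14 28] block[of 29 52] block[of 33 66] block[of 47 88]
        by (auto simp: exceptional_def)
    qed
    then show False using contra[of "F - 1"] lt f True
      by (auto simp: F_def opt_cost_exceptional)
  next
    case False
    have "c < M + F" using lt f False by simp
    have "r \<le> 2 * M" using n by (simp add: r_def)
    have not_exc: "(r, M) \<noteq> (10, 5)" "(r, M) \<noteq> (28, 14)" "(r, M) \<noteq> (52, 29)" "(r, M) \<noteq> (66, 33)" "(r, M) \<noteq> (88, 47)"
      using False by (auto simp: nr exceptional_def)
    note small_r = opt_cost_exceptional opt_cost_table[of 1] opt_cost_table[of 2]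
    show False
    proof (rule contra)
      show "c < M + F" by fact
    next
      assume "F + 3 \<le> M"
      show "F * F + 3 * F + 4 < r + 4 * M"
      proof (cases "r \<in> {0, 2, 4, 10}")
        case True
        then show ?thesis using \<open>F + 3 \<le> M\<close> small_r
          by (auto simp: F_def opt_table_def)
      next
        case False
        then show ?thesis using sm \<open>r \<le> 2 * M\<close> unfolding small_cost_def by simp
      qed
    next
      show "F * M + F * F \<le> M * M + r"
      proof (cases "r = 10")
        case True
        then have "M \<ge> 6" using not_exc(1) \<open>r \<le> 2 * M\<close> by simp
        then have "6 * M \<le> M * M" by (intro mult_mono) auto
        then have "4 * M + 6 \<le> M * M" using \<open>M \<ge> 6\<close> by linarith
        then show ?thesis using True by (simp add: F_def opt_cost_exceptional)
      next
        case False
        then have "F * F + F * R \<le> R * R + 2 * R" and "F \<le> R"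
          using sm by (simp_all add: small_cost_def r_def)
        moreover obtain e where e: "M = R + e" using n(2) le_Suc_ex by blast
        moreover have "F * e \<le> R * e" using \<open>F \<le> R\<close> by simp
        ultimately have "F * F + F * R + F * e \<le> R * R + 2 * R + R * e + (R * e + e * e)"
          by linarith
        then show ?thesis by (simp add: r_def e algebra_simps)
      qed
    next
      assume M: "M = m + 1"
      then have a: "a = r + 2 * M" using nr by (simp add: n_def)
      have "opt_cost a \<le> F" using assms(2) \<open>c < M + F\<close> M by simp
      have b52: "\<not> (r = 52 \<and> M = t)" if "t \<in> {26, 27, 28}" for t
      proof
        assume "r = 52 \<and> M = t"
        then have "opt_cost (52 + 2 * t) \<le> 10" using \<open>opt_cost a \<le> F\<close> a
          by (simp add: F_def opt_cost_exceptional)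
        then show False
          using that opt_cost_block[of 14 9] opt_cost_block[of 16 9] opt_cost_block[of 18 9]
            opt_cost_table[of 7] opt_cost_table[of 8] opt_cost_table[of 9]
          by (auto simp: opt_table_def exceptional_def)
      qed
      have b88: "\<not> (r = 88 \<and> M = t)" if "t \<in> {44, 45, 46}" for t
      proof
        assume "r = 88 \<and> M = t"
        then have "opt_cost (88 + 2 * t) \<le> 13" using \<open>opt_cost a \<le> F\<close> a
          by (simp add: F_def opt_cost_exceptional)
        then show False
          using that opt_cost_block[of 20 12] opt_cost_block[of 22 12] opt_cost_block[of 24 12]
            opt_cost_table[of 10] opt_cost_table[of 11] opt_cost_table[of 12]
          by (auto simp: opt_table_def exceptional_def)
      qed
      show "F * F + F < r + 2 * M"
      proof (cases "r \<in> {0, 10, 28, 52, 66, 88}")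
        case True
        moreover have "r = 52 \<Longrightarrow> M \<ge> 30"
          using not_exc(3) \<open>r \<le> 2 * M\<close> b52[of 26] b52[of 27] b52[of 28] by simp
        moreover have "r = 88 \<Longrightarrow> M \<ge> 48"
          using not_exc(5) \<open>r \<le> 2 * M\<close> b88[of 44] b88[of 45] b88[of 46] by simp
        moreover have "r = 10 \<Longrightarrow> M \<ge> 6" "r = 28 \<Longrightarrow> M \<ge> 15" "r = 66 \<Longrightarrow> M \<ge> 34"
          using not_exc \<open>r \<le> 2 * M\<close> by auto
        ultimately consider "r = 0" | "r = 10" "M \<ge> 6" | "r = 28" "M \<ge> 15"
          | "r = 52" "M \<ge> 30" | "r = 66" "M \<ge> 34" | "r = 88" "M \<ge> 48"
          by blast
        then show ?thesis using M by cases (auto simp: F_def opt_cost_exceptional)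
      next
        case False
        then show ?thesis using sm \<open>r \<le> 2 * M\<close> unfolding small_cost_def by simp
      qed
    qed
  qed
qed

section \<open>The minimum cost\<close>

text \<open>Removing the largest part is what makes the crude estimate \<open>n \<le> (m + 1) c\<close> available.\<close>

lemma opt_cost_le_sum:
  fixes m :: "'i \<Rightarrow> nat"
  assumes "finite I"
  shows "opt_cost (\<Sum>i\<in>I. m i * (m i + 1)) \<le> (\<Sum>i\<in>I. m i)"
  using assms
proof (induction "card I" arbitrary: I)
  case 0
  then show ?case by simp
next
  case (Suc k)
  then have "m ` I \<noteq> {}" by auto
  then obtain i where i: "i \<in> I" and max: "\<And>j. j \<in> I \<Longrightarrow> m j \<le> m i"
    using Max_in[of "m ` I"] Max_ge[of "m ` I"] Suc.prems by fastforce
  define a where "a = (\<Sum>j\<in>I - {i}. m j * (m j + 1))"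
  have "opt_cost a \<le> (\<Sum>j\<in>I - {i}. m j)"
    unfolding a_def using Suc.hyps Suc.prems i by (intro Suc.hyps(1)) auto
  then have "opt_cost a + m i \<le> (\<Sum>j\<in>I. m j)"
    by (simp add: sum.remove[OF Suc.prems i])
  moreover have n: "(\<Sum>j\<in>I. m j * (m j + 1)) = a + m i * (m i + 1)"
    by (simp add: a_def sum.remove[OF Suc.prems i])
  moreover have "(\<Sum>j\<in>I. m j * (m j + 1)) \<le> (m i + 1) * (\<Sum>j\<in>I. m j)"
    unfolding sum_distrib_left using max by (intro sum_mono) (simp add: mult.commute)
  moreover have "even a" unfolding a_def by (intro dvd_sum) auto
  ultimately show ?case by (metis opt_cost_exchange)
qed

lemma opt_cost_le_eq_cost:
  assumes "finite A" and "equiv A r"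
  shows "opt_cost (eq_size r) \<le> eq_cost A r"
proof -
  have "finite (A // r)" using assms by (meson equiv_def finite_quotient)
  then have "opt_cost (\<Sum>C\<in>A // r. (card C - 1) * (card C - 1 + 1)) \<le> eq_cost A r"
    unfolding eq_cost_def by (rule opt_cost_le_sum)
  moreover have "(card C - 1) * (card C - 1 + 1) = card C * (card C - 1)" for C :: "'a set"
    by (cases "card C") auto
  ultimately show ?thesis using eq_size_eq_sum[OF assms] by simp
qed

text \<open>A class of \<open>m + 1\<close> fresh elements is added to a relation of minimum cost.\<close>

lemma min_cost_add_class:
  assumes "even n"
  shows "min_cost (n + m * (m + 1)) \<le> min_cost n + m"
proof -
  obtain A :: "nat set" and r where Ar: "finite A" "equiv A r" "eq_size r = n" "eq_cost A r = min_cost n"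
    using min_cost_attained[OF assms] by blast
  obtain N where N: "\<And>x. x \<in> A \<Longrightarrow> x < N"
    using Ar(1) unfolding finite_nat_set_iff_bounded by blast
  define B where "B = {N..<N + (m + 1)}"
  define s where "s = r \<union> B \<times> B"
  have B: "finite B" "card B = m + 1" "A \<inter> B = {}" using N by (force simp: B_def)+
  then have "B \<noteq> {}" by auto
  have rA: "r \<subseteq> A \<times> A" using Ar(2) by (simp add: equiv_def)
  have eqs: "equiv (A \<union> B) s"
  proof (rule equivI)
    show "s \<subseteq> (A \<union> B) \<times> (A \<union> B)" using rA by (auto simp: s_def)
    show "refl_on (A \<union> B) s" using Ar(2) by (auto simp: s_def equiv_def refl_on_def)
    show "sym s" using Ar(2) by (auto simp: s_def equiv_def sym_def)
    have "trans r" using Ar(2) by (simp add: equiv_def)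
    show "trans s"
    proof (rule transI)
      fix x y z assume "(x, y) \<in> s" "(y, z) \<in> s"
      then show "(x, z) \<in> s"
        using subsetD[OF rA, of "(x, y)"] subsetD[OF rA, of "(y, z)"] B(3)
          transD[OF \<open>trans r\<close>, of x y z]
        by (auto simp: s_def)
    qed
  qed
  have quot: "(A \<union> B) // s = insert B (A // r)"
  proof -
    have "s `` {x} = r `` {x}" if "x \<in> A" for x using that B(3) by (auto simp: s_def)
    then have "A // s = A // r" by (auto simp: quotient_def)
    moreover have "s `` {x} = B" if "x \<in> B" for x using that B(3) rA by (auto simp: s_def)
    then have "B // s = {B}" using \<open>B \<noteq> {}\<close> by (auto simp: quotient_def)
    moreover have "(A \<union> B) // s = A // s \<union> B // s" by (auto simp: quotient_def)
    ultimately show ?thesis by simp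
  qed
  have notin: "B \<notin> A // r"
    using in_quotient_imp_subset[OF Ar(2), of B] B(3) \<open>B \<noteq> {}\<close> by blast
  have fin: "finite (A // r)" using Ar by (meson equiv_def finite_quotient)
  have "eq_size s = n + m * (m + 1)"
    using eq_size_eq_sum[OF _ eqs] eq_size_eq_sum[OF Ar(1,2)] Ar B quot notin fin by simp
  moreover have "eq_cost (A \<union> B) s = min_cost n + m"
    using Ar B quot notin fin by (simp add: eq_cost_def)
  ultimately show ?thesis
    using min_cost_le[OF _ eqs, of "n + m * (m + 1)"] Ar B by simp
qed

lemma min_cost_eq_opt_cost:
  assumes "even n"
  shows "min_cost n = opt_cost n"
proof (rule antisym)
  show "opt_cost n \<le> min_cost n"
    using min_cost_attained[OF assms] opt_cost_le_eq_cost by metis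
  have "equiv {} ({} :: (nat \<times> nat) set)" by (simp add: equiv_def refl_on_def sym_def trans_def)
  then have 0: "min_cost 0 = 0"
    using min_cost_le[of "{} :: nat set" "{}" 0] by (simp add: eq_size_def eq_cost_def)
  show "min_cost n \<le> opt_cost n"
    using assms
  proof (induction n rule: less_induct)
    case (less n)
    show ?case
    proof (cases "n \<in> exceptional")
      case True
      have two: "min_cost (p * (p + 1) + q * (q + 1)) \<le> p + q" for p q
        using min_cost_add_class[of 0 p] min_cost_add_class[of "p * (p + 1)" q] 0 by simp
      \<comment> \<open>For instance \<open>40 = 20 + 20\<close> costs \<open>4 + 4\<close>, but greedily \<open>40 = 30 + 6 + 2 + 2\<close> costs \<open>5 + 2 + 1 + 1\<close>.\<close>
      show ?thesis
        using True two[of 4 4] two[of 13 7] two[of 28 10] two[of 32 11] two[of 46 13]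
        by (auto simp: exceptional_def opt_cost_exceptional)
    next
      case False
      obtain m R where n: "n = m * (m + 1) + 2 * R" "R \<le> m"
        by (rule obtain_even_block[OF less.prems])
      show ?thesis
      proof (cases "m = 0")
        case True
        then show ?thesis using n 0 by simp
      next
        case m: False
        then have "min_cost (2 * R) \<le> opt_cost (2 * R)" using n by (intro less.IH) auto
        moreover have "opt_cost n = m + opt_cost (2 * R)"
          using opt_cost_block[of "2 * R" m] n False by simp
        ultimately show ?thesis
          using min_cost_add_class[of "2 * R" m] n by (simp add: add.commute)
      qed
    qed
  qed
qed

section \<open>The greedy sequence\<close>

lemma greedy_rem_1: "greedy_rem n (Suc 0) = n"
  by (subst greedy_rem_eq) simp

text \<open>Dropping the first greedy step gives the greedy sequence of the first remainder; this turns
  sums over the steps into recursions of the shape of \<open>opt_cost_block\<close>.\<close>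

lemma greedy_rem_Suc:
  assumes "1 \<le> j"
  shows "greedy_rem n (Suc j)
    = greedy_rem (n - rhombic_floor n * (rhombic_floor n - 1)) j"
  using assms
proof (induction j rule: less_induct)
  case (less j)
  define t where "t = rhombic_floor n"
  have "(\<Sum>i = 1..<Suc j. greedy_part n i * (greedy_part n i - 1))
    = t * (t - 1) + (\<Sum>i = Suc 1..<Suc j. greedy_part n i * (greedy_part n i - 1))"
    using less.prems by (subst sum.atLeast_Suc_lessThan) (auto simp: greedy_part_def greedy_rem_1 t_def)
  also have "(\<Sum>i = Suc 1..<Suc j. greedy_part n i * (greedy_part n i - 1))
    = (\<Sum>i = 1..<j. greedy_part n (Suc i) * (greedy_part n (Suc i) - 1))"
    by (subst sum.atLeast_Suc_lessThan_Suc_shift) (simp add: comp_def)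
  also have "\<dots> = (\<Sum>i = 1..<j. greedy_part (n - t * (t - 1)) i * (greedy_part (n - t * (t - 1)) i - 1))"
    using less.IH by (intro sum.cong) (auto simp: greedy_part_def t_def)
  finally show ?case
    by (subst (1 2) greedy_rem_eq) (simp add: t_def)
qed

lemma greedy_steps_0: "greedy_steps 0 = {}"
  by (auto simp: greedy_steps_def greedy_rem_eq)

lemma greedy_steps_rec:
  assumes "n > 0"
  defines "n' \<equiv> n - rhombic_floor n * (rhombic_floor n - 1)"
  shows "greedy_steps n = insert 1 (Suc ` greedy_steps n')"
proof (rule set_eqI)
  fix j
  show "j \<in> greedy_steps n \<longleftrightarrow> j \<in> insert 1 (Suc ` greedy_steps n')"
  proof (cases j)
    case (Suc i)
    then show ?thesis using assms greedy_rem_Suc[of i n]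
      by (cases "i = 0") (auto simp: greedy_steps_def greedy_rem_1 image_iff)
  qed (auto simp: greedy_steps_def)
qed

lemma sum_greedy_steps_block:
  fixes g :: "nat \<Rightarrow> 'b :: comm_monoid_add"
  assumes "R \<le> m" and "m > 0"
  shows "(\<Sum>j\<in>greedy_steps (m * (m + 1) + 2 * R). g (greedy_rem (m * (m + 1) + 2 * R) j))
    = g (m * (m + 1) + 2 * R) + (\<Sum>j\<in>greedy_steps (2 * R). g (greedy_rem (2 * R) j))"
proof -
  define n where "n = m * (m + 1) + 2 * R"
  have "n - rhombic_floor n * (rhombic_floor n - 1) = 2 * R"
    unfolding n_def using assms by (subst (1 2) rhombic_floor_block) auto
  then have rem: "greedy_rem n (Suc j) = greedy_rem (2 * R) j" if "1 \<le> j" for j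
    using greedy_rem_Suc[OF that, of n] by simp
  have steps: "greedy_steps n = insert 1 (Suc ` greedy_steps (2 * R))"
    using greedy_steps_rec[of n] \<open>_ = 2 * R\<close> assms by (simp add: n_def)
  have "1 \<notin> Suc ` greedy_steps (2 * R)" by (auto simp: greedy_steps_def)
  moreover have "finite (greedy_steps (2 * R))" by (rule finite_greedy_steps) simp
  moreover have "(\<Sum>j\<in>greedy_steps (2 * R). g (greedy_rem n (Suc j)))
      = (\<Sum>j\<in>greedy_steps (2 * R). g (greedy_rem (2 * R) j))"
    by (intro sum.cong) (auto simp: rem greedy_steps_def)
  ultimately show ?thesis
    unfolding n_def[symmetric] steps by (simp add: sum.reindex greedy_rem_1)
qed

definition exceptional_count :: "nat \<Rightarrow> nat" where
  "exceptional_count n = (\<Sum>j\<in>greedy_steps n. if greedy_rem n j \<in> exceptional then 1 else 0)"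

lemma exceptional_count_0: "exceptional_count 0 = 0"
  by (simp add: exceptional_count_def greedy_steps_0)

lemma exceptional_count_block:
  assumes "R \<le> m" and "m > 0"
  shows "exceptional_count (m * (m + 1) + 2 * R)
    = (if m * (m + 1) + 2 * R \<in> exceptional then 1 else 0) + exceptional_count (2 * R)"
  unfolding exceptional_count_def by (rule sum_greedy_steps_block[OF assms])

text \<open>At the largest exceptional remainder the chain continues with 10, 28, 52, 66 or 88,
  and from there it meets no exceptional number.\<close>

lemma exceptional_count_le_1:
  assumes "even n"
  shows "exceptional_count n \<le> 1"
  using assms
proof (induction n rule: less_induct)
  case (less n)
  obtain m R where n: "n = m * (m + 1) + 2 * R" "R \<le> m"
    by (rule obtain_even_block[OF less.prems])
  note block = exceptional_count_block
  have 2: "exceptional_count 2 = 0"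
    using block[of 0 1] by (simp add: exceptional_count_0 exceptional_def numeral_2_eq_2)
  have "exceptional_count (1 * (1 + 1) + 2 * 1) = 0"
    using 2 by (subst block) (auto simp: exceptional_def)
  moreover have "1 * (1 + 1) + 2 * 1 = (4 :: nat)" by simp
  ultimately have 4: "exceptional_count 4 = 0" by metis
  have 8: "exceptional_count 8 = 0" using block[of 1 2] 2 by (simp add: exceptional_def)
  have 10: "exceptional_count 10 = 0" using block[of 2 2] 4 by (simp add: exceptional_def)
  have 16: "exceptional_count 16 = 0" using block[of 2 3] 4 by (simp add: exceptional_def)
  show ?case
  proof (cases "n \<in> exceptional")
    case True
    have "exceptional_count 28 = 0" using block[of 4 4] 8 by (simp add: exceptional_def)
    moreover have "exceptional_count 52 = 0" using block[of 5 6] 10 by (simp add: exceptional_def)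
    moreover have "exceptional_count 66 = 0" using block[of 5 7] 10 by (simp add: exceptional_def)
    moreover have "exceptional_count 88 = 0" using block[of 8 8] 16 by (simp add: exceptional_def)
    ultimately show ?thesis
      using True 10 block[of 5 5] block[of 14 14] block[of 26 29] block[of 33 33] block[of 44 47]
      by (auto simp: exceptional_def)
  next
    case False
    show ?thesis
    proof (cases "m = 0")
      case True
      then show ?thesis using n by (simp add: exceptional_count_0)
    next
      case m: False
      then have "exceptional_count (2 * R) \<le> 1" using n by (intro less.IH) auto
      then show ?thesis using block[of R m] n m False by simp
    qed
  qed
qed

lemma opt_cost_eq_greedy:
  assumes "even n"
  shows "int (opt_cost n)
    = (\<Sum>j\<in>greedy_steps n. int (greedy_part n j) - 1) - int (exceptional_count n)"
  using assms
proof (induction n rule: less_induct)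
  case (less n)
  obtain m R where n: "n = m * (m + 1) + 2 * R" "R \<le> m"
    by (rule obtain_even_block[OF less.prems])
  show ?case
  proof (cases "m = 0")
    case True
    then show ?thesis using n by (simp add: exceptional_count_0 greedy_steps_0)
  next
    case False
    define e :: nat where "e = (if n \<in> exceptional then 1 else 0)"
    have "rhombic_floor n = m + 1" unfolding n(1) using n(2) by (intro rhombic_floor_block) simp
    then have "(\<Sum>j\<in>greedy_steps n. int (greedy_part n j) - 1)
        = int m + (\<Sum>j\<in>greedy_steps (2 * R). int (greedy_part (2 * R) j) - 1)"
      using sum_greedy_steps_block[OF n(2), of "\<lambda>x. int (rhombic_floor x) - 1"] False
      unfolding n(1)[symmetric] by (simp add: greedy_part_def)
    moreover have "exceptional_count n = e + exceptional_count (2 * R)"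
      using exceptional_count_block[OF n(2)] False unfolding n(1)[symmetric] by (simp add: e_def)
    moreover have "opt_cost n = m + opt_cost (2 * R) - e" and "e \<le> m"
      using opt_cost_block[of "2 * R" m] n False by (auto simp: e_def simp flip: n(1))
    moreover have "int (opt_cost (2 * R)) = (\<Sum>j\<in>greedy_steps (2 * R). int (greedy_part (2 * R) j) - 1)
        - int (exceptional_count (2 * R))"
      using n False by (intro less.IH) auto
    ultimately show ?thesis by simp
  qed
qed

lemma even_eq_size:
  assumes "finite A" and "equiv A r"
  shows "even (eq_size r)"
  unfolding eq_size_eq_sum[OF assms] by (intro dvd_sum) auto

theorem theorem10:
  fixes A :: "'a set" and r :: "('a \<times> 'a) set" and n :: nat
  assumes "finite A" and "equiv A r" and "eq_size r = n"
  shows "((\<forall>j\<in>greedy_steps n. greedy_rem n j \<notin> exceptional) \<longrightarrow>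
            int (eq_cost A r) \<ge> (\<Sum>j\<in>greedy_steps n. int (greedy_part n j) - 1) \<and>
            int (min_cost n) = (\<Sum>j\<in>greedy_steps n. int (greedy_part n j) - 1)) \<and>
         (\<forall>j\<in>greedy_steps n. greedy_rem n j \<in> exceptional \<longrightarrow>
            (\<forall>i\<in>greedy_steps n. greedy_rem n i \<in> exceptional \<longrightarrow> i = j) \<and>
            int (min_cost n) = - 1 + (\<Sum>j\<in>greedy_steps n. int (greedy_part n j) - 1))"
proof -
  have "even n" using even_eq_size[OF assms(1,2)] assms(3) by simp
  define E where "E = {j \<in> greedy_steps n. greedy_rem n j \<in> exceptional}"
  have finE: "finite E" using finite_greedy_steps[OF \<open>even n\<close>] by (simp add: E_def)
  have count: "exceptional_count n = card E"
    using finite_greedy_steps[OF \<open>even n\<close>]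
    by (simp add: exceptional_count_def E_def Int_def flip: sum.inter_filter)
  have min: "int (min_cost n) = (\<Sum>j\<in>greedy_steps n. int (greedy_part n j) - 1) - int (card E)"
    using min_cost_eq_opt_cost opt_cost_eq_greedy count \<open>even n\<close> by simp
  have "min_cost n \<le> eq_cost A r" by (rule min_cost_le[OF assms])
  show ?thesis
  proof (intro conjI impI ballI)
    assume "\<forall>j\<in>greedy_steps n. greedy_rem n j \<notin> exceptional"
    then have "E = {}" by (auto simp: E_def)
    then show "int (min_cost n) = (\<Sum>j\<in>greedy_steps n. int (greedy_part n j) - 1)"
      using min by simp
    then show "(\<Sum>j\<in>greedy_steps n. int (greedy_part n j) - 1) \<le> int (eq_cost A r)"
      using \<open>min_cost n \<le> eq_cost A r\<close> by linarith
  next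
    fix i j
    assume "i \<in> greedy_steps n" "greedy_rem n i \<in> exceptional"
      "j \<in> greedy_steps n" "greedy_rem n j \<in> exceptional"
    then show "i = j"
      using exceptional_count_le_1[OF \<open>even n\<close>] count finE
      by (simp add: card_le_Suc0_iff_eq E_def)
  next
    fix j
    assume "j \<in> greedy_steps n" "greedy_rem n j \<in> exceptional"
    then have "card E > 0" using finE by (auto simp: E_def card_gt_0_iff)
    then have "card E = 1" using exceptional_count_le_1[OF \<open>even n\<close>] count by simp
    then show "int (min_cost n) = - 1 + (\<Sum>j\<in>greedy_steps n. int (greedy_part n j) - 1)"
      using min by simp
  qed
qed

end
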